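(* Let $(J_1,\circ)$ be the Jordan algebra over $\mathbb{C}$ with basis $\{e_1,e_2\}$ and $e_1\circ e_1=2e_1$, $e_2\circ e_2=2e_2$, $e_1\circ e_2=e_2\circ e_1=0$. Any Rota-Baxter operator $R$ on $(J_1,\circ)$ is zero, and the induced pre-Jordan algebra, given by $x\cdot y=R(x)\circ y$, is isomorphic to the $2$-dimensional pre-Jordan algebra with zero multiplication.
   Context: A Rota-Baxter operator (of weight $0$) on a Jordan algebra $(J,\circ)$ is a linear map $R:J\to J$ with $R(x)\circ R(y)=R(R(x)\circ y+x\circ R(y))$ for all $x,y\in J$. The pre-Jordan algebra induced by $R$ is $J$ with the multiplication $x\cdot y:=R(x)\circ y$. *)

theory Defs
  imports "HOL-Analysis.Analysis"
begin

locale algebra_over = vector_space smul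
  for smul :: "'k::field_char_0 \<Rightarrow> 'v::ab_group_add \<Rightarrow> 'v" +
  fixes mul :: "'v \<Rightarrow> 'v \<Rightarrow> 'v"
  assumes linear_left: "Vector_Spaces.linear smul smul (\<lambda>x. mul x y)"
    and linear_right: "Vector_Spaces.linear smul smul (\<lambda>y. mul x y)"

locale jordan_algebra = algebra_over smul mul
  for smul :: "'k::field_char_0 \<Rightarrow> 'v::ab_group_add \<Rightarrow> 'v"
    and mul :: "'v \<Rightarrow> 'v \<Rightarrow> 'v" +
  assumes commute: "mul x y = mul y x"
    and jordan_identity:
      "mul (mul x y) (mul x x) = mul x (mul y (mul x x))"

locale rota_baxter_operator = jordan_algebra smul mul
  for smul :: "'k::field_char_0 \<Rightarrow> 'v::ab_group_add \<Rightarrow> 'v"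
    and mul :: "'v \<Rightarrow> 'v \<Rightarrow> 'v" +
  fixes R :: "'v \<Rightarrow> 'v"
  assumes linear_R: "Vector_Spaces.linear smul smul R"
    and rota_baxter_identity:
      "mul (R x) (R y) = R (mul (R x) y + mul x (R y))"

definition symm_mul :: "('v \<Rightarrow> 'v \<Rightarrow> 'v::ab_group_add) \<Rightarrow> 'v \<Rightarrow> 'v \<Rightarrow> 'v" where
  "symm_mul mul x y = mul x y + mul y x"

text \<open>The identities of Hou, Ni and Bai, stated for the product
  \<open>x \<circ> y = x \<cdot> y + y \<cdot> x\<close> without the factor \<open>1/2\<close>.\<close>

locale pre_jordan_algebra = algebra_over smul mul
  for smul :: "'k::field_char_0 \<Rightarrow> 'v::ab_group_add \<Rightarrow> 'v"
    and mul :: "'v \<Rightarrow> 'v \<Rightarrow> 'v" +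
  assumes pre_jordan_1:
      "mul (symm_mul mul x y) (mul z u) + mul (symm_mul mul y z) (mul x u)
         + mul (symm_mul mul z x) (mul y u)
       = mul z (mul (symm_mul mul x y) u) + mul x (mul (symm_mul mul y z) u)
         + mul y (mul (symm_mul mul z x) u)"
    and pre_jordan_2:
      "mul x (mul y (mul z u)) + mul z (mul y (mul x u))
         + mul (symm_mul mul (symm_mul mul x z) y) u
       = mul z (mul (symm_mul mul x y) u) + mul x (mul (symm_mul mul y z) u)
         + mul y (mul (symm_mul mul z x) u)"

definition induced_mul :: "('v \<Rightarrow> 'v \<Rightarrow> 'v) \<Rightarrow> ('v \<Rightarrow> 'v) \<Rightarrow> 'v \<Rightarrow> 'v \<Rightarrow> 'v" where
  "induced_mul mul R x y = mul (R x) y"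

definition pre_jordan_isomorphic ::
  "('k::field_char_0 \<Rightarrow> 'v::ab_group_add \<Rightarrow> 'v) \<Rightarrow> ('v \<Rightarrow> 'v \<Rightarrow> 'v) \<Rightarrow>
   ('k \<Rightarrow> 'w::ab_group_add \<Rightarrow> 'w) \<Rightarrow> ('w \<Rightarrow> 'w \<Rightarrow> 'w) \<Rightarrow> bool" where
  "pre_jordan_isomorphic smul mul smul' mul' \<longleftrightarrow>
     pre_jordan_algebra smul mul \<and> pre_jordan_algebra smul' mul' \<and>
     (\<exists>\<phi>. Vector_Spaces.linear smul smul' \<phi> \<and> bij \<phi> \<and>
          (\<forall>x y. \<phi> (mul x y) = mul' (\<phi> x) (\<phi> y)))"

text \<open>The multiplication table of \<open>J\<^sub>1\<close> does define a Jordan algebra, realised on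
  \<open>\<complex>\<^sup>2\<close> with its standard basis.\<close>

lemma J1_model:
  defines "mul \<equiv> (\<lambda>x y. \<chi> i. 2 * x $ i * y $ i) :: complex^2 \<Rightarrow> complex^2 \<Rightarrow> complex^2"
    and "e1 \<equiv> axis 1 1 :: complex^2" and "e2 \<equiv> axis 2 1 :: complex^2"
  shows "jordan_algebra (*s) mul"
    and "e1 \<noteq> e2" and "vec.independent {e1, e2}" and "vec.span {e1, e2} = UNIV"
    and "mul e1 e1 = 2 *s e1" and "mul e2 e2 = 2 *s e2"
    and "mul e1 e2 = 0" and "mul e2 e1 = 0"
proof -
  have b: "{e1, e2} = cart_basis"
    by (auto simp: cart_basis_def e1_def e2_def exhaust_2) (metis exhaust_2)
  show "jordan_algebra (*s) mul"
    by unfold_locales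
      (auto simp: mul_def vec_eq_iff algebra_simps)
  show "e1 \<noteq> e2" by (simp add: e1_def e2_def axis_eq_axis)
  show "vec.independent {e1, e2}" "vec.span {e1, e2} = UNIV"
    unfolding b by (rule independent_cart_basis, rule span_cart_basis)
  show "mul e1 e1 = 2 *s e1" "mul e2 e2 = 2 *s e2" "mul e1 e2 = 0" "mul e2 e1 = 0"
    by (auto simp: mul_def e1_def e2_def vec_eq_iff axis_def)
qed

end

theory Submission
  imports Defs
begin

text \<open>Write \<open>e\<close> for one of the two basis vectors and \<open>f\<close> for the other, and \<open>R e = a e + b f\<close>.
  Multiplication by \<open>e\<close> annihilates \<open>f\<close>, so the Rota-Baxter identity at the pair \<open>(e, e)\<close> becomes
  \<open>2a\<^sup>2 e + 2b\<^sup>2 f = R (4a e) = 4a\<^sup>2 e + 4ab f\<close>. Comparing coefficients gives first \<open>a = 0\<close>, then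
  \<open>b = 0\<close> (lemma \<open>vanishes_on_scaled_idempotent\<close>). The situation is symmetric in \<open>e\<close> and \<open>f\<close>, so
  \<open>R\<close> kills a basis. The induced product is then zero, and zero products on two vector spaces of
  equal dimension are intertwined by any linear bijection, in particular by coordinates
  with respect to the basis (lemma \<open>coordinate_isomorphism\<close>).\<close>

context vector_space
begin

lemma span_pairE:
  assumes "x \<in> span {e, f}"
  obtains a b where "x = scale a e + scale b f"
proof -
  obtain a where "x - scale a e \<in> span {f}"
    using assms by (auto simp: span_insert)
  then obtain b where "x - scale a e = scale b f"
    by (auto simp: span_singleton)
  then show thesis
    using that by (metis add.commute diff_add_cancel)
qed

lemma independent_pair_coeffs_zero:
  assumes "independent {e, f}" "e \<noteq> f" "scale a e + scale b f = 0"
  shows "a = 0" "b = 0"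
proof -
  let ?u = "\<lambda>v. if v = e then a else b"
  have "(\<Sum>v\<in>{e, f}. scale (?u v) v) = 0"
    using assms(2,3) by simp
  then have "?u v = 0" if "v \<in> {e, f}" for v
    using independentD[OF assms(1), of "{e, f}" ?u v] that by simp
  from this[of e] this[of f] show "a = 0" "b = 0"
    using assms(2) by auto
qed

end

lemma coordinate_isomorphism:
  fixes smul :: "'k::field \<Rightarrow> 'v::ab_group_add \<Rightarrow> 'v" and e f :: 'v
  assumes "vector_space smul"
    and "\<not> module.dependent smul {e, f}" "e \<noteq> f" "module.span smul {e, f} = UNIV"
  shows "\<exists>\<phi> :: 'v \<Rightarrow> 'k^2. Vector_Spaces.linear smul (*s) \<phi> \<and> bij \<phi>"
proof -
  interpret vector_space smul by fact
  interpret vs: vector_space_pair "(*s) :: 'k \<Rightarrow> 'k^2 \<Rightarrow> 'k^2" smul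
    by unfold_locales
  define \<psi> :: "'k^2 \<Rightarrow> 'v" where "\<psi> v = smul (v $ 1) e + smul (v $ 2) f" for v
  have lin: "Vector_Spaces.linear (*s) smul \<psi>"
    by unfold_locales (simp_all add: \<psi>_def algebra_simps)
  have "v = 0" if "\<psi> v = 0" for v
    using independent_pair_coeffs_zero[OF assms(2,3) that[unfolded \<psi>_def]]
    by (simp add: vec_eq_iff forall_2)
  then have inj: "inj \<psi>"
    using vs.linear_inj_iff_eq_0[OF lin] by blast
  have surj: "surj \<psi>"
    unfolding surj_def
  proof
    fix x
    obtain a b where "x = smul a e + smul b f"
      using span_pairE assms(4) by blast
    then have "x = \<psi> (vector [a, b])"
      by (simp add: \<psi>_def)
    then show "\<exists>v. x = \<psi> v" ..
  qed
  obtain \<phi> where \<phi>: "Vector_Spaces.linear smul (*s) \<phi>" "\<phi> \<circ> \<psi> = id"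
    using vs.linear_injective_left_inverse[OF lin inj] by blast
  have "\<phi> x = inv \<psi> x" for x
    using \<phi>(2) surj_f_inv_f[OF surj, of x] by (metis comp_apply id_apply)
  then have "\<phi> = inv \<psi>" ..
  then have "bij \<phi>"
    using inj surj bij_imp_bij_inv[of \<psi>] by (simp add: bij_def)
  with \<phi>(1) show ?thesis by blast
qed

lemma pre_jordan_algebra_zero_mul:
  assumes "vector_space smul"
  shows "pre_jordan_algebra smul (\<lambda>x y. 0)"
proof -
  interpret vector_space smul by fact
  show ?thesis by unfold_locales simp_all
qed

context rota_baxter_operator
begin

text \<open>If \<open>R e = a e + b f\<close>, the \<open>e\<close>-coefficients in the Rota-Baxter identity at \<open>(e, e)\<close> give
  \<open>2a\<^sup>2 = 4a\<^sup>2\<close>. The \<open>f\<close>-coefficients give \<open>2b\<^sup>2 = 4ab\<close>, where the left side comes from \<open>f \<circ> f = 2f\<close>;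
  in characteristic zero this leaves only \<open>a = b = 0\<close>. Only the value of \<open>R\<close> at \<open>e\<close> is
  involved, because \<open>R e \<circ> e\<close> is a multiple of \<open>e\<close>.\<close>

lemma vanishes_on_scaled_idempotent:
  assumes indep: "independent {e, f}" "e \<noteq> f"
    and ee: "mul e e = smul 2 e" and ff: "mul f f = smul 2 f" and ef: "mul e f = 0"
    and Re_span: "R e \<in> span {e, f}"
  shows "R e = 0"
proof -
  have add_l: "mul (x + y) z = mul x z + mul y z"
    and scale_l: "mul (smul c x) z = smul c (mul x z)" for x y z c
    using linear_left[of z] by (auto simp: Vector_Spaces.linear_iff)
  have add_r: "mul z (x + y) = mul z x + mul z y"
    and scale_r: "mul z (smul c x) = smul c (mul z x)" for x y z c
    using linear_right[of z] by (auto simp: Vector_Spaces.linear_iff)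
  have R_scale: "R (smul c x) = smul c (R x)" for c x
    using linear_R by (auto simp: Vector_Spaces.linear_iff)
  have fe: "mul f e = 0"
    using ef commute[of f e] by simp
  note bilinear = add_l scale_l add_r scale_r ee ff ef fe
  obtain a b where Re: "R e = smul a e + smul b f"
    using Re_span by (rule span_pairE)
  have "mul (R e) (R e) = smul (2 * a\<^sup>2) e + smul (2 * b\<^sup>2) f"
    by (simp add: Re bilinear scale_right_distrib power2_eq_square ac_simps)
  moreover have "mul (R e) e + mul e (R e) = smul (4 * a) e"
    by (simp add: Re bilinear flip: scale_left_distrib)
  then have "R (mul (R e) e + mul e (R e)) = smul (4 * a\<^sup>2) e + smul (4 * a * b) f"
    by (simp add: R_scale) (simp add: Re scale_right_distrib power2_eq_square mult.assoc)
  ultimately have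
    "smul (2 * a\<^sup>2) e + smul (2 * b\<^sup>2) f = smul (4 * a\<^sup>2) e + smul (4 * a * b) f"
    using rota_baxter_identity[of e e] by metis
  then have "smul (4 * a\<^sup>2 - 2 * a\<^sup>2) e + smul (4 * a * b - 2 * b\<^sup>2) f = 0"
    by (simp only: scale_left_diff_distrib) (simp only: add_diff_add[symmetric] diff_self)
  from independent_pair_coeffs_zero[OF indep this]
  have "a = 0" "b = 0" by auto
  then show ?thesis by (simp add: Re)
qed

end

theorem proposition5p5:
  fixes smul :: "complex \<Rightarrow> 'v::ab_group_add \<Rightarrow> 'v"
    and jmul :: "'v \<Rightarrow> 'v \<Rightarrow> 'v"
    and e1 e2 :: 'v
    and R :: "'v \<Rightarrow> 'v"
  assumes "jordan_algebra smul jmul"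
    and "e1 \<noteq> e2"
    and "\<not> module.dependent smul {e1, e2}"
    and "module.span smul {e1, e2} = UNIV"
    and "jmul e1 e1 = smul 2 e1"
    and "jmul e2 e2 = smul 2 e2"
    and "jmul e1 e2 = 0"
    and "jmul e2 e1 = 0"
    and "rota_baxter_operator smul jmul R"
  shows "R = (\<lambda>x. 0) \<and>
    pre_jordan_isomorphic smul (induced_mul jmul R)
      ((*s) :: complex \<Rightarrow> complex^2 \<Rightarrow> complex^2) (\<lambda>x y. 0)"
proof -
  interpret rota_baxter_operator smul jmul R by fact
  have "R e1 = 0" "R e2 = 0"
    using assms(2-8) vanishes_on_scaled_idempotent[of e1 e2]
      vanishes_on_scaled_idempotent[of e2 e1]
    by (simp_all add: insert_commute[of e2 e1])
  moreover have "\<exists>a b. x = smul a e1 + smul b e2" for x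
    using span_pairE[of x e1 e2] assms(4) by blast
  ultimately have R0: "R = (\<lambda>x. 0)"
    using linear_R by (metis Vector_Spaces.linear_iff scale_zero_right)
  have "jmul 0 y = 0" for y
    using linear_left[of y] by (metis Vector_Spaces.linear_iff scale_zero_left)
  then have ind0: "induced_mul jmul R = (\<lambda>x y. 0)"
    by (simp add: induced_mul_def R0 fun_eq_iff)
  obtain \<phi> :: "'v \<Rightarrow> complex^2" where \<phi>: "Vector_Spaces.linear smul (*s) \<phi>" "bij \<phi>"
    using coordinate_isomorphism[OF vector_space_axioms assms(3,2,4)] by blast
  have "\<phi> 0 = 0"
    using \<phi>(1) by (metis Vector_Spaces.linear_iff scale_zero_left vec.scale_zero_left)
  with \<phi> have "pre_jordan_isomorphic smul (induced_mul jmul R) ((*s)) (\<lambda>x y. 0 :: complex^2)"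
    unfolding pre_jordan_isomorphic_def ind0
    using pre_jordan_algebra_zero_mul[OF vector_space_axioms]
      pre_jordan_algebra_zero_mul[OF vec.vector_space_axioms] by blast
  with R0 show ?thesis by blast
qed

end
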